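(* Let $\theta(n)$ denote the largest interval thickness of a graph on $n$ vertices. Then $\theta(n)=o(n)$, i.e. $\theta(n)/n\to 0$ as $n\to\infty$.
   Context: All graphs are finite and simple. A graph $G=(V,E)$ is interval colorable if there is an edge-coloring $c\colon E\to\mathbb{Z}$ such that for every vertex $x$ the multiset $\{c(xy): xy\in E\}$ is a set of consecutive integers (in particular $c$ is a proper edge-coloring). The interval thickness $\theta(G)$ of a graph $G$ is the smallest integer $k$ such that the edge set of $G$ can be partitioned into $k$ sets, each of which forms an interval colorable graph. *)

theory Defs
  imports Complex_Main "HOL-Library.Disjoint_Sets"
begin

definition simple_graph :: "'a set \<Rightarrow> 'a set set \<Rightarrow> bool" where
  "simple_graph V E \<longleftrightarrow> finite V \<and> (\<forall>e\<in>E. e \<subseteq> V \<and> card e = 2)"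

(* Injectivity on the edges at x says that no colour is repeated in the multiset of colours
   at x; for an isolated vertex the interval {a..b} is empty (b < a). *)
definition interval_colorable :: "'a set \<Rightarrow> 'a set set \<Rightarrow> bool" where
  "interval_colorable V E \<longleftrightarrow>
     (\<exists>c :: 'a set \<Rightarrow> int. \<forall>x\<in>V.
        inj_on c {e\<in>E. x \<in> e} \<and> (\<exists>a b. c ` {e\<in>E. x \<in> e} = {a..b}))"

(* The parts of a partition_on are nonempty; allowing empty parts would not change the minimum. *)
definition interval_thickness :: "'a set \<Rightarrow> 'a set set \<Rightarrow> nat" where
  "interval_thickness V E =
     (LEAST k. \<exists>P. partition_on E P \<and> card P = k \<and> (\<forall>F\<in>P. interval_colorable V F))"

(* Vertices are natural numbers; by interval_thickness_le_max_interval_thickness below this loses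
   no graph. The set is finite and nonempty, so Max is a genuine maximum. *)
definition max_interval_thickness :: "nat \<Rightarrow> nat" where
  "max_interval_thickness n =
     Max {interval_thickness V E | (V :: nat set) E. simple_graph V E \<and> card V = n}"

lemma simple_graph_finite_edges: "simple_graph V E \<Longrightarrow> finite E"
  unfolding simple_graph_def by (meson PowI finite_Pow_iff finite_subset subsetI)

lemma interval_colorable_single: "interval_colorable V {e}"
proof -
  have "\<exists>a b. (\<lambda>_. 0::int) ` {e'\<in>{e}. x \<in> e'} = {a..b}" for x
  proof (cases "x \<in> e")
    case True
    then have "(\<lambda>_. 0::int) ` {e'\<in>{e}. x \<in> e'} = {0..0}" by auto
    then show ?thesis by blast
  next
    case False
    then have "(\<lambda>_. 0::int) ` {e'\<in>{e}. x \<in> e'} = {1..0}" by auto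
    then show ?thesis by blast
  qed
  moreover have "inj_on (\<lambda>_. 0::int) {e'\<in>{e}. x \<in> e'}" for x
    by (auto simp: inj_on_def)
  ultimately show ?thesis
    unfolding interval_colorable_def by (intro exI[of _ "\<lambda>_. 0::int"]) blast
qed

lemma interval_partition_singletons:
  "\<exists>P. partition_on E P \<and> card P = card E \<and> (\<forall>F\<in>P. interval_colorable V F)"
proof (intro exI conjI)
  show "partition_on E ((\<lambda>e. {e}) ` E)"
    by (rule partition_on_singletons)
  show "card ((\<lambda>e. {e}) ` E) = card E" by (simp add: card_image)
  show "\<forall>F\<in>(\<lambda>e. {e}) ` E. interval_colorable V F" by (auto intro: interval_colorable_single)
qed

lemma interval_thickness_attained:
  "\<exists>P. partition_on E P \<and> card P = interval_thickness V E \<and> (\<forall>F\<in>P. interval_colorable V F)"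
  unfolding interval_thickness_def by (rule LeastI) (rule interval_partition_singletons)

lemma interval_thickness_le:
  "partition_on E P \<Longrightarrow> (\<And>F. F \<in> P \<Longrightarrow> interval_colorable V F) \<Longrightarrow> interval_thickness V E \<le> card P"
  unfolding interval_thickness_def by (rule Least_le) blast

lemma interval_thickness_bound:
  assumes "simple_graph V E" shows "interval_thickness V E \<le> 2 ^ card V"
proof -
  have "interval_thickness V E \<le> card E"
    unfolding interval_thickness_def by (rule Least_le) (rule interval_partition_singletons)
  also have "\<dots> \<le> card (Pow V)"
    using assms by (intro card_mono) (auto simp: simple_graph_def)
  finally show ?thesis using assms by (simp add: card_Pow simple_graph_def)
qed

lemma finite_interval_thickness_values:
  "finite {interval_thickness V E | (V :: nat set) E. simple_graph V E \<and> card V = n}"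
  by (rule finite_subset[of _ "{..2 ^ n}"]) (use interval_thickness_bound in auto)

lemma max_interval_thickness_attained:
  "\<exists>(V :: nat set) E. simple_graph V E \<and> card V = n \<and>
     interval_thickness V E = max_interval_thickness n"
proof -
  have "simple_graph {..<n} {}" by (simp add: simple_graph_def)
  then have "{interval_thickness V E | (V :: nat set) E. simple_graph V E \<and> card V = n} \<noteq> {}"
    using card_lessThan by blast
  from Max_in[OF finite_interval_thickness_values this]
  obtain V :: "nat set" and E where "max_interval_thickness n = interval_thickness V E"
    "simple_graph V E" "card V = n"
    unfolding max_interval_thickness_def by blast
  then show ?thesis by metis
qed

lemma interval_colorable_image:
  assumes inj: "inj_on g V" and F: "\<And>e. e \<in> F \<Longrightarrow> e \<subseteq> V" and col: "interval_colorable V F"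
  shows "interval_colorable (g ` V) ((`) g ` F)"
proof -
  obtain c :: "'a set \<Rightarrow> int" where c: "\<And>x. x \<in> V \<Longrightarrow> inj_on c {e\<in>F. x \<in> e}"
    "\<And>x. x \<in> V \<Longrightarrow> \<exists>a b. c ` {e\<in>F. x \<in> e} = {a..b}"
    using col unfolding interval_colorable_def by blast
  define h where "h = the_inv_into V g"
  define d where "d = (\<lambda>e. c (h ` e))"
  have h: "h ` g ` e = e" if "e \<in> F" for e
  proof -
    have "h (g x) = x" if "x \<in> e" for x
      using F[OF \<open>e \<in> F\<close>] that inj unfolding h_def by (intro the_inv_into_f_f) auto
    then show ?thesis by (simp add: image_image)
  qed
  have "inj_on d {e \<in> (`) g ` F. g x \<in> e} \<and> (\<exists>a b. d ` {e \<in> (`) g ` F. g x \<in> e} = {a..b})"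
    if x: "x \<in> V" for x
  proof -
    have eq: "{e \<in> (`) g ` F. g x \<in> e} = (`) g ` {e\<in>F. x \<in> e}"
    proof -
      have "g x \<in> g ` e \<longleftrightarrow> x \<in> e" if "e \<in> F" for e
        using inj_on_image_mem_iff[OF inj x F[OF that]] .
      then show ?thesis by blast
    qed
    have "d ` {e \<in> (`) g ` F. g x \<in> e} = c ` {e\<in>F. x \<in> e}"
      unfolding eq image_image d_def by (rule image_cong) (auto simp: h[unfolded image_image])
    moreover have "inj_on d ((`) g ` {e\<in>F. x \<in> e})"
      using c(1)[OF x] by (auto simp: inj_on_def d_def h)
    ultimately show ?thesis using c(2)[OF x] eq by simp
  qed
  then show ?thesis unfolding interval_colorable_def by blast
qed

lemma interval_thickness_image_le:
  assumes inj: "inj_on g V" and G: "simple_graph V E"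
  shows "interval_thickness (g ` V) ((`) g ` E) \<le> interval_thickness V E"
proof -
  obtain P where P: "partition_on E P" "card P = interval_thickness V E"
    "\<forall>F\<in>P. interval_colorable V F"
    using interval_thickness_attained by blast
  have E: "E \<subseteq> Pow V" using G by (auto simp: simple_graph_def)
  have "inj_on ((`) g) E" using inj_on_image_Pow[OF inj] E inj_on_subset by blast
  then have part: "partition_on ((`) g ` E) ((`) ((`) g) ` P - {{}})"
    by (rule partition_on_inj_image[OF P(1)])
  have "interval_colorable (g ` V) F" if "F \<in> (`) ((`) g) ` P - {{}}" for F
    using that P E inj by (auto simp: partition_on_def intro!: interval_colorable_image)
  from interval_thickness_le[OF part this]
  have "interval_thickness (g ` V) ((`) g ` E) \<le> card ((`) ((`) g) ` P - {{}})" .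
  also have "finite P"
    using simple_graph_finite_edges[OF G] P(1) by (metis finite_elements)
  then have "card ((`) ((`) g) ` P - {{}}) \<le> card P"
    by (meson Diff_subset card_image_le card_mono finite_imageI order_trans)
  finally show ?thesis using P(2) by simp
qed

lemma interval_thickness_le_max_interval_thickness:
  fixes V :: "'a set"
  assumes G: "simple_graph V E"
  shows "interval_thickness V E \<le> max_interval_thickness (card V)"
proof -
  have "finite V" using G by (simp add: simple_graph_def)
  then obtain f :: "'a \<Rightarrow> nat" where f: "inj_on f V"
    using finite_imp_inj_to_nat_seg by blast
  define W where "W = f ` V"
  define D where "D = (`) f ` E"
  define g where "g = the_inv_into V f"
  have g: "g (f x) = x" if "x \<in> V" for x using that f by (simp add: g_def the_inv_into_f_f)
  have W: "simple_graph W D" "card W = card V"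
  proof -
    have "card (f ` e) = card e" if "e \<in> E" for e
      using that G inj_on_subset[OF f] by (intro card_image) (auto simp: simple_graph_def)
    then show "simple_graph W D"
      using G by (auto simp: simple_graph_def W_def D_def)
    show "card W = card V" unfolding W_def by (rule card_image[OF f])
  qed
  have "inj_on g W" by (auto simp: inj_on_def W_def g)
  moreover have "g ` W = V" by (simp add: W_def g image_image)
  moreover have "g ` f ` e = e" if "e \<in> E" for e
  proof -
    have "g (f x) = x" if "x \<in> e" for x
      using that \<open>e \<in> E\<close> G g unfolding simple_graph_def by blast
    then show ?thesis by (simp add: image_image)
  qed
  then have "(`) g ` D = E" unfolding D_def by (subst image_image) simp
  ultimately have "interval_thickness V E \<le> interval_thickness W D"
    using interval_thickness_image_le[of g W D] W by simp
  also have "\<dots> \<le> max_interval_thickness (card V)"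
    unfolding max_interval_thickness_def
    using W by (intro Max_ge finite_interval_thickness_values) blast
  finally show ?thesis .
qed

end

theory Submission
  imports Defs
begin

text \<open>
  Complete bipartite graphs are interval colorable, and so are vertex-disjoint unions of them. As
  long as at least \<open>\<delta>\<^sup>2 * n\<^sup>2\<close> edges are left, the Kovari-Sos-Turan theorem yields vertex-disjoint
  copies of \<open>K\<^sub>t\<^sub>,\<^sub>t\<close> that cover a positive proportion \<open>\<epsilon>\<close> of the vertices, hence an interval
  colorable subgraph with at least \<open>\<epsilon> * t / 2 * n\<close> edges. Since \<open>t\<close> is arbitrary, at most \<open>\<delta> * n\<close>
  such subgraphs have to be removed. The remaining graph has at most \<open>2 * \<delta> * n\<close> vertices of degree
  more than \<open>\<delta> * n\<close>. The edges at these form as many stars, and the other edges split greedily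
  into \<open>2 * \<delta> * n\<close> matchings.
\<close>

section \<open>Interval colorable graphs\<close>

lemma interval_colorableI:
  fixes c :: "'a set \<Rightarrow> int"
  assumes "\<And>x. x \<in> V \<Longrightarrow> inj_on c {e\<in>E. x \<in> e}"
    and "\<And>x. x \<in> V \<Longrightarrow> \<exists>a b. c ` {e\<in>E. x \<in> e} = {a..b}"
  shows "interval_colorable V E"
  unfolding interval_colorable_def using assms by blast

text \<open>Settles every vertex on at most one edge; a vertex on no edge gets the empty interval
  \<open>{1..0}\<close>.\<close>

lemma image_eq_int_interval_if_subsingleton:
  fixes c :: "'b \<Rightarrow> int"
  assumes "\<And>d e. d \<in> A \<Longrightarrow> e \<in> A \<Longrightarrow> d = e"
  shows "inj_on c A \<and> (\<exists>a b. c ` A = {a..b})"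
proof (cases "A = {}")
  case True
  then have "c ` A = {1..0}" by simp
  with True show ?thesis by (metis inj_on_empty)
next
  case False
  then obtain e where "A = {e}" using assms by blast
  then have "c ` A = {c e..c e}" by simp
  with \<open>A = {e}\<close> show ?thesis by (metis inj_on_insert inj_on_empty Diff_empty Diff_insert0 image_empty empty_iff)
qed

lemma interval_colorable_matching:
  assumes "\<And>d e. d \<in> F \<Longrightarrow> e \<in> F \<Longrightarrow> d \<inter> e \<noteq> {} \<Longrightarrow> d = e"
  shows "interval_colorable V F"
proof -
  have "inj_on (\<lambda>_. 0::int) {e\<in>F. x \<in> e} \<and> (\<exists>a b. (\<lambda>_. 0::int) ` {e\<in>F. x \<in> e} = {a..b})" for x
    by (rule image_eq_int_interval_if_subsingleton) (use assms in blast)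
  then show ?thesis by (intro interval_colorableI) auto
qed

text \<open>Numbering the edges consecutively gives the centre \<open>x\<close> an interval. Any
  other vertex \<open>y\<close> lies on at most one edge, namely \<open>{x, y}\<close>.\<close>

lemma interval_colorable_star:
  assumes "finite F" and star: "\<And>e. e \<in> F \<Longrightarrow> x \<in> e \<and> card e = 2"
  shows "interval_colorable V F"
proof -
  obtain f where f: "bij_betw f F {0..<card F}"
    using ex_bij_betw_finite_nat[OF \<open>finite F\<close>] by blast
  define c where "c = int \<circ> f"
  have inj: "inj_on c F"
    using f unfolding c_def by (simp add: bij_betw_def comp_inj_on)
  have img: "c ` F = {0..int (card F) - 1}"
  proof -
    have "c ` F = int ` f ` F" by (simp add: c_def image_comp)
    also have "f ` F = {0..<card F}" using f by (simp add: bij_betw_def)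
    also have "int ` {0..<card F} = {0..int (card F) - 1}"
      by (auto simp: image_int_atLeastLessThan)
    finally show ?thesis .
  qed
  have "inj_on c {e\<in>F. y \<in> e} \<and> (\<exists>a b. c ` {e\<in>F. y \<in> e} = {a..b})" for y
  proof (cases "y = x")
    case True
    then have "{e\<in>F. y \<in> e} = F" using star by blast
    then show ?thesis using inj img by auto
  next
    case False
    have edge: "e = {x, y}" if "e \<in> F" "y \<in> e" for e
    proof -
      have "x \<in> e" "card e = 2" using star that by auto
      then show ?thesis using that False by (auto simp: card_2_iff)
    qed
    show ?thesis
      by (rule image_eq_int_interval_if_subsingleton) (use edge in auto)
  qed
  then show ?thesis by (intro interval_colorableI) auto
qed

text \<open>No vertex meets edges of both graphs, so the two colorings can be glued without
  adjusting either of them.\<close>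

lemma interval_colorable_disjoint_Un:
  assumes F: "interval_colorable V F" and G: "interval_colorable V G"
    and disj: "\<Union>F \<inter> \<Union>G = {}"
  shows "interval_colorable V (F \<union> G)"
proof -
  obtain c where c: "\<And>x. x \<in> V \<Longrightarrow> inj_on c {e\<in>F. x \<in> e}"
    "\<And>x. x \<in> V \<Longrightarrow> \<exists>a b. c ` {e\<in>F. x \<in> e} = {a..b::int}"
    using F unfolding interval_colorable_def by blast
  obtain d where d: "\<And>x. x \<in> V \<Longrightarrow> inj_on d {e\<in>G. x \<in> e}"
    "\<And>x. x \<in> V \<Longrightarrow> \<exists>a b. d ` {e\<in>G. x \<in> e} = {a..b::int}"
    using G unfolding interval_colorable_def by blast
  define h where "h = (\<lambda>e. if e \<in> F then c e else d e)"
  have "inj_on h {e\<in>F \<union> G. x \<in> e} \<and> (\<exists>a b. h ` {e\<in>F \<union> G. x \<in> e} = {a..b})"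
    if x: "x \<in> V" for x
  proof (cases "x \<in> \<Union>F")
    case True
    then have eq: "{e\<in>F \<union> G. x \<in> e} = {e\<in>F. x \<in> e}" using disj by blast
    have "h ` {e\<in>F. x \<in> e} = c ` {e\<in>F. x \<in> e}" by (intro image_cong) (auto simp: h_def)
    moreover have "inj_on h {e\<in>F. x \<in> e}"
      using c(1)[OF x] by (auto simp: inj_on_def h_def)
    ultimately show ?thesis using c(2)[OF x] unfolding eq by simp
  next
    case False
    then have eq: "{e\<in>F \<union> G. x \<in> e} = {e\<in>G. x \<in> e}" by blast
    have notF: "e \<notin> F" if "x \<in> e" for e using False that by blast
    have "h ` {e\<in>G. x \<in> e} = d ` {e\<in>G. x \<in> e}" by (intro image_cong) (auto simp: h_def notF)
    moreover have "inj_on h {e\<in>G. x \<in> e}"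
      using d(1)[OF x] by (auto simp: inj_on_def h_def notF)
    ultimately show ?thesis using d(2)[OF x] unfolding eq by simp
  qed
  then show ?thesis by (intro interval_colorableI) auto
qed

section \<open>Complete bipartite graphs\<close>

definition complete_bipartite :: "'a set \<Rightarrow> 'a set \<Rightarrow> 'a set set" where
  "complete_bipartite A B = (\<lambda>(a, b). {a, b}) ` (A \<times> B)"

lemma complete_bipartite_commute: "complete_bipartite A B = complete_bipartite B A"
  unfolding complete_bipartite_def by force

lemma Union_complete_bipartite_subset: "\<Union>(complete_bipartite A B) \<subseteq> A \<union> B"
  unfolding complete_bipartite_def by auto

lemma card_complete_bipartite:
  assumes "A \<inter> B = {}"
  shows "card (complete_bipartite A B) = card A * card B"
proof -
  have "inj_on (\<lambda>(a, b). {a, b}) (A \<times> B)"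
    using assms by (auto simp: inj_on_def doubleton_eq_iff)
  then show ?thesis
    unfolding complete_bipartite_def by (simp add: card_image card_cartesian_product)
qed

lemma complete_bipartite_sum_coloring_at:
  fixes g :: "'a \<Rightarrow> int"
  assumes disj: "A \<inter> B = {}" and inj: "inj_on g B" and img: "g ` B = {l..u}" and x: "x \<in> A"
  shows "inj_on (sum g) {e\<in>complete_bipartite A B. x \<in> e} \<and>
    (\<exists>a b. sum g ` {e\<in>complete_bipartite A B. x \<in> e} = {a..b})"
proof -
  have eq: "{e\<in>complete_bipartite A B. x \<in> e} = (\<lambda>b. {x, b}) ` B"
    using x disj unfolding complete_bipartite_def by auto
  have val: "sum g {x, b} = g x + g b" if "b \<in> B" for b
    using that x disj by (subst sum.insert) auto
  have "sum g ` (\<lambda>b. {x, b}) ` B = (\<lambda>i. g x + i) ` g ` B"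
    unfolding image_image by (rule image_cong) (auto simp: val)
  also have "\<dots> = {g x + l..g x + u}" unfolding img by simp
  finally have "sum g ` (\<lambda>b. {x, b}) ` B = {g x + l..g x + u}" .
  moreover have "inj_on (sum g) ((\<lambda>b. {x, b}) ` B)"
    using inj by (auto simp: inj_on_def val)
  ultimately show ?thesis unfolding eq by blast
qed

text \<open>Label each side by consecutive integers from 0 and color an edge by the sum of its end
  labels. The colors at a vertex are then a translate of the labels on the opposite side.\<close>

lemma interval_colorable_complete_bipartite:
  assumes fin: "finite A" "finite B" and disj: "A \<inter> B = {}"
  shows "interval_colorable V (complete_bipartite A B)"
proof -
  obtain p where p: "bij_betw p A {0..<card A}"
    using ex_bij_betw_finite_nat[OF fin(1)] by blast
  obtain q where q: "bij_betw q B {0..<card B}"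
    using ex_bij_betw_finite_nat[OF fin(2)] by blast
  define g where "g = (\<lambda>x. int (if x \<in> A then p x else q x))"
  have int_img: "int ` {0..<k} = {0..int k - 1}" for k
    by (auto simp: image_int_atLeastLessThan)
  have gA: "inj_on g A" "g ` A = {0..int (card A) - 1}"
  proof -
    show "inj_on g A" using p by (auto simp: g_def bij_betw_def inj_on_def)
    have "g ` A = int ` p ` A" unfolding image_image by (rule image_cong) (auto simp: g_def)
    then show "g ` A = {0..int (card A) - 1}" using p int_img by (simp add: bij_betw_def)
  qed
  have notA: "x \<notin> A" if "x \<in> B" for x using that disj by blast
  have gB: "inj_on g B" "g ` B = {0..int (card B) - 1}"
  proof -
    show "inj_on g B" using q by (auto simp: g_def bij_betw_def inj_on_def notA)
    have "g ` B = int ` q ` B" unfolding image_image by (rule image_cong) (auto simp: g_def notA)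
    then show "g ` B = {0..int (card B) - 1}" using q int_img by (simp add: bij_betw_def)
  qed
  have "inj_on (sum g) {e\<in>complete_bipartite A B. x \<in> e} \<and>
    (\<exists>a b. sum g ` {e\<in>complete_bipartite A B. x \<in> e} = {a..b})" for x
  proof -
    consider "x \<in> A" | "x \<in> B" | "x \<notin> A \<union> B" by blast
    then show ?thesis
    proof cases
      case 1
      then show ?thesis by (rule complete_bipartite_sum_coloring_at[OF disj gB])
    next
      case 2
      have "B \<inter> A = {}" using disj by blast
      from complete_bipartite_sum_coloring_at[OF this gA 2]
      show ?thesis by (simp only: complete_bipartite_commute[of B A])
    next
      case 3
      then have "{e\<in>complete_bipartite A B. x \<in> e} = {}"
        using Union_complete_bipartite_subset[of A B] by blast
      then show ?thesis by (intro image_eq_int_interval_if_subsingleton) blast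
    qed
  qed
  then show ?thesis by (intro interval_colorableI) auto
qed

section \<open>Upper bounds for the interval thickness\<close>

lemma interval_thickness_Un_le:
  assumes "E \<inter> F = {}"
  shows "interval_thickness V (E \<union> F) \<le> interval_thickness V E + interval_thickness V F"
proof -
  obtain P where P: "partition_on E P" "card P = interval_thickness V E"
    "\<forall>F\<in>P. interval_colorable V F"
    using interval_thickness_attained by blast
  obtain Q where Q: "partition_on F Q" "card Q = interval_thickness V F"
    "\<forall>F\<in>Q. interval_colorable V F"
    using interval_thickness_attained by blast
  have "partition_on (E \<union> F) (P \<union> Q)"
    using P(1) Q(1) assms unfolding partition_on_def
    by (auto intro!: disjoint_union)
  then have "interval_thickness V (E \<union> F) \<le> card (P \<union> Q)"
    by (rule interval_thickness_le) (use P Q in auto)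
  also have "\<dots> \<le> card P + card Q" by (rule card_Un_le)
  finally show ?thesis using P Q by simp
qed

lemma interval_thickness_empty: "interval_thickness V {} = 0"
  using interval_thickness_le[of "{}" "{}" V] by (simp add: partition_on_def)

lemma interval_thickness_le_1:
  assumes "interval_colorable V F"
  shows "interval_thickness V F \<le> 1"
proof (cases "F = {}")
  case True
  then show ?thesis by (simp add: interval_thickness_empty)
next
  case False
  then have "partition_on F {F}" by (simp add: partition_on_def)
  from interval_thickness_le[OF this, of V] show ?thesis using assms by simp
qed

section \<open>Sparse graphs: matchings and stars\<close>

lemma interval_thickness_le_if_classes:
  assumes col: "\<And>e. e \<in> E \<Longrightarrow> c e < (k::nat)"
    and cls: "\<And>i. i < k \<Longrightarrow> interval_colorable V {e\<in>E. c e = i}"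
  shows "interval_thickness V E \<le> k"
proof -
  define P where "P = (\<lambda>i. {e\<in>E. c e = i}) ` {..<k} - {{}}"
  have "partition_on E P"
    using col unfolding partition_on_def P_def disjoint_def by auto
  then have "interval_thickness V E \<le> card P"
    by (rule interval_thickness_le) (use cls in \<open>auto simp: P_def\<close>)
  also have "\<dots> \<le> card ((\<lambda>i. {e\<in>E. c e = i}) ` {..<k})"
    unfolding P_def by (intro card_mono) auto
  also have "\<dots> \<le> k" using card_image_le[of "{..<k}"] by simp
  finally show ?thesis .
qed

text \<open>The element inserted last conflicts with fewer than \<open>k\<close> others, so these
  block fewer than \<open>k\<close> colors and one is left. Removing it only shrinks the conflict
  sets of the others, so the induction applies.\<close>

lemma greedy_coloring:
  assumes "finite E" and sym: "\<And>d e. R d e \<Longrightarrow> R e d"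
    and "\<And>e. e \<in> E \<Longrightarrow> card {d\<in>E. d \<noteq> e \<and> R d e} < k"
  shows "\<exists>c. (\<forall>e\<in>E. c e < k) \<and> (\<forall>d\<in>E. \<forall>e\<in>E. d \<noteq> e \<longrightarrow> R d e \<longrightarrow> c d \<noteq> c e)"
  using assms(1,3)
proof (induction E rule: finite_induct)
  case empty
  then show ?case by simp
next
  case (insert e0 E)
  have "card {d\<in>E. d \<noteq> e \<and> R d e} < k" if "e \<in> E" for e
  proof -
    have "card {d\<in>E. d \<noteq> e \<and> R d e} \<le> card {d\<in>insert e0 E. d \<noteq> e \<and> R d e}"
      using insert.hyps by (intro card_mono) auto
    with insert.prems[of e] that show ?thesis by simp
  qed
  then obtain c where c: "\<And>e. e \<in> E \<Longrightarrow> c e < k"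
    "\<And>d e. d \<in> E \<Longrightarrow> e \<in> E \<Longrightarrow> d \<noteq> e \<Longrightarrow> R d e \<Longrightarrow> c d \<noteq> c e"
    using insert.IH by blast
  define D where "D = {d\<in>insert e0 E. d \<noteq> e0 \<and> R d e0}"
  have "card (c ` D) < k"
    using card_image_le[of D c] insert.prems[of e0] insert.hyps unfolding D_def by simp
  then have "\<not> {..<k} \<subseteq> c ` D"
    using card_mono[of "c ` D" "{..<k}"] insert.hyps by (auto simp: D_def)
  then obtain i where i: "i < k" "i \<notin> c ` D" by blast
  have new: "c d \<noteq> i" if "d \<in> E" "d \<noteq> e0" "R d e0" for d
    using i that unfolding D_def by blast
  show ?case
    by (rule exI[of _ "c(e0 := i)"]) (use c i new sym in \<open>auto; metis\<close>)
qed

lemma interval_thickness_le_max_degree: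
  assumes G: "simple_graph V E" and deg: "\<And>x. x \<in> V \<Longrightarrow> card {e\<in>E. x \<in> e} \<le> d"
  shows "interval_thickness V E \<le> 2 * d"
proof -
  have fin: "finite E" by (rule simple_graph_finite_edges[OF G])
  have "card {f\<in>E. f \<noteq> e \<and> f \<inter> e \<noteq> {}} < 2 * d" if e: "e \<in> E" for e
  proof -
    obtain x y where xy: "e = {x, y}" "x \<in> V" "y \<in> V"
      using G e unfolding simple_graph_def by (auto simp: card_2_iff)
    \<comment> \<open>The inclusion is strict because \<open>e\<close> itself lies only on the
      right. This saves the one color that \<open>greedy_coloring\<close> needs, so
      \<open>2 * d\<close> colors suffice.\<close>
    have "{f\<in>E. f \<noteq> e \<and> f \<inter> e \<noteq> {}} \<subset> {f\<in>E. x \<in> f} \<union> {f\<in>E. y \<in> f}"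
      using e xy by auto
    then have "card {f\<in>E. f \<noteq> e \<and> f \<inter> e \<noteq> {}} < card ({f\<in>E. x \<in> f} \<union> {f\<in>E. y \<in> f})"
      using fin by (intro psubset_card_mono) auto
    also have "\<dots> \<le> card {f\<in>E. x \<in> f} + card {f\<in>E. y \<in> f}" by (rule card_Un_le)
    also have "\<dots> \<le> 2 * d" using deg[OF xy(2)] deg[OF xy(3)] by simp
    finally show ?thesis .
  qed
  then obtain c where c: "\<forall>e\<in>E. c e < 2 * d"
    "\<forall>f\<in>E. \<forall>e\<in>E. f \<noteq> e \<longrightarrow> f \<inter> e \<noteq> {} \<longrightarrow> c f \<noteq> c e"
    using greedy_coloring[OF fin, of "\<lambda>f e. f \<inter> e \<noteq> {}" "2 * d"] by (auto simp: Int_commute)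
  show ?thesis
    by (rule interval_thickness_le_if_classes[of _ c])
      (use c in \<open>auto intro!: interval_colorable_matching\<close>)
qed

text \<open>Each vertex of \<open>S\<close> contributes one star. An edge with both ends in
  \<open>S\<close> is counted only once, since the star at a new vertex \<open>x\<close> takes only
  edges that avoid the earlier vertices.\<close>

lemma interval_thickness_edges_at_le:
  assumes "finite S" and "finite E" and "\<And>e. e \<in> E \<Longrightarrow> card e = 2"
  shows "interval_thickness V {e\<in>E. e \<inter> S \<noteq> {}} \<le> card S"
  using assms(1)
proof (induction S rule: finite_induct)
  case empty
  then show ?case by (simp add: interval_thickness_empty)
next
  case (insert x S)
  let ?A = "{e\<in>E. e \<inter> S \<noteq> {}}" and ?B = "{e\<in>E. x \<in> e \<and> e \<inter> S = {}}"
  have eq: "{e\<in>E. e \<inter> insert x S \<noteq> {}} = ?A \<union> ?B" by auto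
  have "interval_thickness V ?B \<le> 1"
    by (intro interval_thickness_le_1 interval_colorable_star[of _ x]) (use assms in auto)
  moreover have "interval_thickness V (?A \<union> ?B) \<le> interval_thickness V ?A + interval_thickness V ?B"
    by (rule interval_thickness_Un_le) auto
  ultimately show ?case using insert unfolding eq by simp
qed

lemma sum_degrees:
  assumes "simple_graph V E"
  shows "(\<Sum>x\<in>V. card {e\<in>E. x \<in> e}) = 2 * card E"
proof (rule sum_multicount)
  show "finite V" "finite E"
    using assms simple_graph_finite_edges by (auto simp: simple_graph_def)
  show "\<forall>e\<in>E. card {x\<in>V. x \<in> e} = 2"
  proof
    fix e assume "e \<in> E"
    then have "{x\<in>V. x \<in> e} = e" "card e = 2" using assms by (auto simp: simple_graph_def)
    then show "card {x\<in>V. x \<in> e} = 2" by simp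
  qed
qed

lemma interval_thickness_sparse:
  fixes \<delta> :: real
  assumes G: "simple_graph V E" and "\<delta> > 0" and n: "n = card V" "n > 0"
    and sparse: "card E \<le> \<delta>\<^sup>2 * n\<^sup>2"
  shows "interval_thickness V E \<le> 4 * \<delta> * n"
proof -
  define S where "S = {x\<in>V. \<delta> * n < card {e\<in>E. x \<in> e}}"
  define d where "d = nat \<lfloor>\<delta> * n\<rfloor>"
  have fin: "finite V" "finite E" "finite S"
    using G simple_graph_finite_edges by (auto simp: simple_graph_def S_def)
  have two: "card e = 2" if "e \<in> E" for e using G that by (simp add: simple_graph_def)
  let ?A = "{e\<in>E. e \<inter> S \<noteq> {}}" and ?B = "{e\<in>E. e \<inter> S = {}}"
  have "interval_thickness V (?A \<union> ?B) \<le> interval_thickness V ?A + interval_thickness V ?B"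
    by (rule interval_thickness_Un_le) auto
  also have "?A \<union> ?B = E" by auto
  also have "interval_thickness V ?A \<le> card S"
    by (rule interval_thickness_edges_at_le) (use fin two in auto)
  also have "interval_thickness V ?B \<le> 2 * d"
  proof (rule interval_thickness_le_max_degree)
    show "simple_graph V ?B" using G by (auto simp: simple_graph_def)
    fix x assume "x \<in> V"
    show "card {e\<in>?B. x \<in> e} \<le> d"
    proof (cases "x \<in> S")
      case True
      then have "{e\<in>?B. x \<in> e} = {}" by blast
      then show ?thesis by (metis card.empty le0)
    next
      case False
      then have "card {e\<in>E. x \<in> e} \<le> \<delta> * n" using \<open>x \<in> V\<close> by (simp add: S_def)
      then have "card {e\<in>E. x \<in> e} \<le> d" unfolding d_def by (simp add: le_nat_floor)
      moreover have "card {e\<in>?B. x \<in> e} \<le> card {e\<in>E. x \<in> e}"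
        using fin by (intro card_mono) auto
      ultimately show ?thesis by simp
    qed
  qed
  finally have th: "interval_thickness V E \<le> card S + 2 * d" by simp
  \<comment> \<open>The handshake lemma bounds the number of high-degree vertices: their degrees
    alone sum to at most \<open>2 * card E\<close>.\<close>
  have "card S * (\<delta> * n) \<le> (\<Sum>x\<in>S. real (card {e\<in>E. x \<in> e}))"
    by (rule sum_bounded_below[where K = "\<delta> * n"]) (auto simp: S_def)
  also have "\<dots> \<le> (\<Sum>x\<in>V. real (card {e\<in>E. x \<in> e}))"
    using fin by (intro sum_mono2) (auto simp: S_def)
  also have "\<dots> = 2 * card E" using sum_degrees[OF G] by (simp flip: of_nat_sum)
  also have "\<dots> \<le> (2 * \<delta> * n) * (\<delta> * n)" using sparse by (simp add: power2_eq_square mult_ac)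
  finally have "card S \<le> 2 * \<delta> * n"
    using \<open>\<delta> > 0\<close> n by (simp add: mult_le_cancel_right)
  moreover have "d \<le> \<delta> * n" unfolding d_def using \<open>\<delta> > 0\<close> by simp
  ultimately show ?thesis using th by linarith
qed

section \<open>Complete bipartite subgraphs of dense graphs\<close>

text \<open>The degree sum is at least twice \<epsilon> n^2, and low-degree vertices account for at
  most half of that. The rest must come from high-degree vertices, each contributing at most
  \<open>n\<close>. Here \<open>n\<close> only bounds \<open>card V\<close>, so that the density can
  later be measured against a larger vertex set.\<close>

lemma many_high_degree_vertices:
  fixes \<epsilon> :: real
  assumes G: "simple_graph V E" and n: "card V \<le> n" and "\<epsilon> > 0" and "n > 0"
    and dense: "\<epsilon> * n\<^sup>2 \<le> card E"
  shows "\<epsilon> * n \<le> card {x\<in>V. \<epsilon> * n \<le> card {e\<in>E. x \<in> e}}"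
proof -
  define S where "S = {x\<in>V. \<epsilon> * n \<le> card {e\<in>E. x \<in> e}}"
  have fin: "finite V" "finite E" "finite S"
    using G simple_graph_finite_edges by (auto simp: simple_graph_def S_def)
  have deg: "card {e\<in>E. x \<in> e} \<le> n" if "x \<in> V" for x
  proof -
    have "{e\<in>E. x \<in> e} \<subseteq> (\<lambda>y. {x, y}) ` V"
    proof
      fix e assume "e \<in> {e\<in>E. x \<in> e}"
      then have "x \<in> e" "card e = 2" "e \<subseteq> V" using G by (auto simp: simple_graph_def)
      then show "e \<in> (\<lambda>y. {x, y}) ` V" by (auto simp: card_2_iff)
    qed
    then have "card {e\<in>E. x \<in> e} \<le> card V" by (rule surj_card_le[OF fin(1)])
    with n show ?thesis by simp
  qed
  have "2 * real (card E) = (\<Sum>x\<in>V. real (card {e\<in>E. x \<in> e}))"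
    using sum_degrees[OF G] by (simp flip: of_nat_sum)
  also have "\<dots> = (\<Sum>x\<in>S. real (card {e\<in>E. x \<in> e})) + (\<Sum>x\<in>V - S. real (card {e\<in>E. x \<in> e}))"
    by (subst sum.subset_diff[of S]) (use fin in \<open>auto simp: S_def\<close>)
  also have "(\<Sum>x\<in>S. real (card {e\<in>E. x \<in> e})) \<le> card S * real n"
    by (rule sum_bounded_above) (use deg in \<open>auto simp: S_def\<close>)
  also have "(\<Sum>x\<in>V - S. real (card {e\<in>E. x \<in> e})) \<le> card (V - S) * (\<epsilon> * n)"
    by (rule sum_bounded_above) (auto simp: S_def)
  also have "card (V - S) * (\<epsilon> * n) \<le> n * (\<epsilon> * n)"
    using n card_mono[of V "V - S"] fin \<open>\<epsilon> > 0\<close> by (intro mult_right_mono) auto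
  finally have "2 * (\<epsilon> * n\<^sup>2) \<le> card S * real n + n * (\<epsilon> * n)" using dense by simp
  then have "(\<epsilon> * n) * n \<le> card S * real n" by (simp add: power2_eq_square algebra_simps)
  then show ?thesis using \<open>n > 0\<close> unfolding S_def by (simp only: mult_le_cancel_right)
qed

text \<open>
  Fix a set \<open>H\<close> of \<open>m\<close> vertices of high degree, where \<open>m\<close> does not depend on \<open>n\<close>. A positive
  proportion of all vertices has at least \<open>t\<close> neighbours in \<open>H\<close>, and there are only \<open>2 ^ m\<close>
  candidates for the neighbourhood in \<open>H\<close>.
\<close>

lemma ex_complete_bipartite:
  fixes \<epsilon> :: real and t :: nat
  assumes "\<epsilon> > 0"
  shows "\<exists>N. \<forall>n\<ge>N. \<forall>(V :: 'a set) E. simple_graph V E \<longrightarrow> card V \<le> n \<longrightarrow> \<epsilon> * n\<^sup>2 \<le> card E \<longrightarrow>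
    (\<exists>A B. A \<subseteq> V \<and> B \<subseteq> V \<and> A \<inter> B = {} \<and> card A = t \<and> card B = t \<and> complete_bipartite A B \<subseteq> E)"
proof -
  \<comment> \<open>With this \<open>m\<close>, a vertex has on average at least \<epsilon> m, hence
    at least \<open>2 * t\<close>, neighbours in \<open>H\<close>, averaging over \<open>n\<close>
    vertices.\<close>
  define m where "m = nat \<lceil>2 * t / \<epsilon>\<rceil> + 1"
  have m: "2 * t \<le> \<epsilon> * m" "m > 0"
  proof -
    have "2 * t / \<epsilon> \<le> m" unfolding m_def by linarith
    then show "2 * t \<le> \<epsilon> * m" using \<open>\<epsilon> > 0\<close> by (simp add: field_simps)
  qed (simp add: m_def)
  \<comment> \<open>The first summand ensures enough high-degree vertices to choose
    \<open>H\<close>; the second leaves \<open>t\<close> vertices per possible neighbourhood for the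
    pigeonhole step.\<close>
  define N where "N = nat \<lceil>m / \<epsilon>\<rceil> + nat \<lceil>2 * (t * 2 ^ m) / \<epsilon>\<rceil> + 1"
  show ?thesis
  proof (intro exI[of _ N] allI impI)
    fix n :: nat and V :: "'a set" and E
    assume "n \<ge> N" and G: "simple_graph V E" and n: "card V \<le> n" and dense: "\<epsilon> * n\<^sup>2 \<le> card E"
    have "m / \<epsilon> \<le> n" "2 * (t * 2 ^ m) / \<epsilon> \<le> n" "n > 0"
      using \<open>n \<ge> N\<close> unfolding N_def by linarith+
    then have large: "m \<le> \<epsilon> * n" "2 * (t * 2 ^ m) \<le> \<epsilon> * n"
      using \<open>\<epsilon> > 0\<close> by (simp_all add: field_simps)
    have fin: "finite V" "finite E"
      using G simple_graph_finite_edges by (auto simp: simple_graph_def)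
    have "m \<le> card {x\<in>V. \<epsilon> * n \<le> card {e\<in>E. x \<in> e}}"
      using many_high_degree_vertices[OF G n \<open>\<epsilon> > 0\<close> \<open>n > 0\<close> dense] large(1) by linarith
    then obtain H where H: "H \<subseteq> {x\<in>V. \<epsilon> * n \<le> card {e\<in>E. x \<in> e}}" "card H = m" "finite H"
      by (rule obtain_subset_with_card_n)
    define nb where "nb = (\<lambda>v. {h\<in>H. {h, v} \<in> E})"
    define W where "W = {v\<in>V. t \<le> card (nb v)}"
    have nb_le: "card (nb v) \<le> m" for v
      using card_mono[of H "nb v"] H by (auto simp: nb_def)
    have deg: "\<epsilon> * n \<le> card {v\<in>V. {h, v} \<in> E}" if "h \<in> H" for h
    proof -
      have "{e\<in>E. h \<in> e} \<subseteq> (\<lambda>v. {h, v}) ` {v\<in>V. {h, v} \<in> E}"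
      proof
        fix e assume e: "e \<in> {e\<in>E. h \<in> e}"
        then have "h \<in> e" "card e = 2" "e \<subseteq> V" using G by (auto simp: simple_graph_def)
        then obtain v where "e = {h, v}" "v \<in> V" by (auto simp: card_2_iff)
        with e show "e \<in> (\<lambda>v. {h, v}) ` {v\<in>V. {h, v} \<in> E}" by blast
      qed
      then have "card {e\<in>E. h \<in> e} \<le> card {v\<in>V. {h, v} \<in> E}"
        by (rule surj_card_le[rotated]) (use fin in auto)
      with H that show ?thesis by (auto intro: order_trans)
    qed
    \<comment> \<open>Count the adjacent pairs between \<open>H\<close> and \<open>V\<close> from
      both sides. Vertices outside \<open>W\<close> account for at most \<open>n * t\<close> pairs,
      which is at most half of the total, so \<open>W\<close> carries the other half.\<close>
    have "m * (\<epsilon> * n) \<le> (\<Sum>h\<in>H. real (card {v\<in>V. {h, v} \<in> E}))"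
      using sum_bounded_below[of H "\<epsilon> * n"] deg H by auto
    also have "(\<Sum>h\<in>H. card {v\<in>V. {h, v} \<in> E}) = (\<Sum>v\<in>V. card (nb v))"
      unfolding nb_def by (rule sum_multicount_gen) (use fin H in auto)
    then have "(\<Sum>h\<in>H. real (card {v\<in>V. {h, v} \<in> E})) = (\<Sum>v\<in>V. real (card (nb v)))"
      by (simp flip: of_nat_sum)
    also have "\<dots> = (\<Sum>v\<in>W. real (card (nb v))) + (\<Sum>v\<in>V - W. real (card (nb v)))"
      by (subst sum.subset_diff[of W]) (use fin in \<open>auto simp: W_def\<close>)
    also have "(\<Sum>v\<in>W. real (card (nb v))) \<le> card W * real m"
      by (rule sum_bounded_above) (use nb_le in auto)
    also have "(\<Sum>v\<in>V - W. real (card (nb v))) \<le> card (V - W) * real t"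
      by (rule sum_bounded_above) (auto simp: W_def)
    also have "card (V - W) * real t \<le> n * real t"
      using n card_mono[of V "V - W"] fin by (intro mult_right_mono) auto
    finally have "m * (\<epsilon> * n) \<le> card W * real m + n * real t" by simp
    moreover have "2 * (n * real t) \<le> m * (\<epsilon> * n)"
      using mult_left_mono[OF m(1), of "real n"] by (simp add: algebra_simps)
    ultimately have "m * (\<epsilon> * n) \<le> m * (2 * real (card W))" by (simp add: algebra_simps)
    then have "\<epsilon> * n \<le> 2 * real (card W)" using m(2) by simp
    then have "real (2 * (t * 2 ^ m)) \<le> real (2 * card W)" using large(2) by simp
    then have W: "t * 2 ^ m \<le> card W" unfolding of_nat_le_iff by simp
    \<comment> \<open>Pigeonhole over the \<open>2 ^ m\<close> possible neighbourhoods. The case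
      \<open>t = 0\<close> is separate because no class can have fewer than 0 elements.\<close>
    have "\<exists>S. S \<in> Pow H \<and> t \<le> card {v\<in>W. nb v = S} \<and> t \<le> card S"
    proof (cases "t = 0")
      case True
      then show ?thesis by auto
    next
      case False
      show ?thesis
      proof (rule ccontr)
        assume none: "\<not> ?thesis"
        have "card {v\<in>W. nb v = S} < t" if "S \<in> Pow H" for S
        proof (cases "t \<le> card S")
          case True
          then show ?thesis using none that not_le by blast
        next
          \<comment> \<open>Vertices of \<open>W\<close> have at least \<open>t\<close> neighbours
            in \<open>H\<close>, so a smaller set is the neighbourhood of none of them.\<close>
          case nle: False
          then have "{v\<in>W. nb v = S} = {}" by (auto simp: W_def)
          then show ?thesis using False by (metis card.empty gr0I)
        qed
        then have "(\<Sum>S\<in>Pow H. card {v\<in>W. nb v = S}) < (\<Sum>S\<in>Pow H. t)"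
          by (intro sum_strict_mono) (use H in auto)
        also have "(\<Sum>S\<in>Pow H. t) = t * 2 ^ m" using H by (simp add: card_Pow)
        also have "(\<Sum>S\<in>Pow H. card {v\<in>W. nb v = S}) = card W"
        proof -
          have "(\<Sum>S\<in>Pow H. card {v\<in>W. nb v = S}) = 1 * card W"
          proof (rule sum_multicount)
            show "\<forall>v\<in>W. card {S\<in>Pow H. nb v = S} = 1"
            proof
              fix v
              have "{S\<in>Pow H. nb v = S} = {nb v}" by (auto simp: nb_def)
              then show "card {S\<in>Pow H. nb v = S} = 1" by simp
            qed
          qed (use H fin in \<open>auto simp: W_def\<close>)
          then show ?thesis by simp
        qed
        finally show False using W by simp
      qed
    qed
    then obtain S where S: "S \<subseteq> H" "t \<le> card {v\<in>W. nb v = S}" "t \<le> card S" by blast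
    obtain A where A: "A \<subseteq> S" "card A = t" by (rule obtain_subset_with_card_n[OF S(3)])
    obtain B where B: "B \<subseteq> {v\<in>W. nb v = S}" "card B = t"
      by (rule obtain_subset_with_card_n[OF S(2)])
    have edge: "{a, b} \<in> E" if "a \<in> A" "b \<in> B" for a b
      using that A B by (auto simp: nb_def)
    have "A \<inter> B = {}"
    proof -
      \<comment> \<open>A common vertex of \<open>A\<close> and \<open>B\<close> would yield a
        loop.\<close>
      have "{x, x} \<notin> E" for x
        using G by (auto simp: simple_graph_def)
      then show ?thesis using edge by blast
    qed
    moreover have "A \<subseteq> V" "B \<subseteq> V" using A B S H by (auto simp: W_def)
    moreover have "complete_bipartite A B \<subseteq> E"
      using edge by (auto simp: complete_bipartite_def)
    ultimately show "\<exists>A B. A \<subseteq> V \<and> B \<subseteq> V \<and> A \<inter> B = {} \<and> card A = t \<and> card B = t \<and>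
        complete_bipartite A B \<subseteq> E"
      using A(2) B(2) by blast
  qed
qed

section \<open>Peeling off interval colorable subgraphs\<close>

lemma card_edges_meeting_le:
  assumes G: "simple_graph V E" and "C \<subseteq> V"
  shows "card {e\<in>E. e \<inter> C \<noteq> {}} \<le> card C * card V"
proof -
  have fin: "finite V" "finite C" using assms by (auto simp: simple_graph_def finite_subset)
  have "{e\<in>E. e \<inter> C \<noteq> {}} \<subseteq> (\<lambda>(x, y). {x, y}) ` (C \<times> V)"
  proof
    fix e assume "e \<in> {e\<in>E. e \<inter> C \<noteq> {}}"
    then obtain x where "x \<in> e" "x \<in> C" "card e = 2" "e \<subseteq> V" using G by (auto simp: simple_graph_def)
    then show "e \<in> (\<lambda>(x, y). {x, y}) ` (C \<times> V)" by (force simp: card_2_iff)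
  qed
  then have "card {e\<in>E. e \<inter> C \<noteq> {}} \<le> card (C \<times> V)"
    by (rule surj_card_le[rotated]) (use fin in auto)
  then show ?thesis by (simp add: card_cartesian_product)
qed

text \<open>
  A maximal family of vertex-disjoint copies of \<open>K\<^sub>t\<^sub>,\<^sub>t\<close> covers at least \<open>\<epsilon> * n\<close> vertices \<open>C\<close>, since
  otherwise the uncovered vertices still span a dense graph. Such a family has \<open>t * card C / 2\<close>
  edges.
\<close>

lemma ex_large_interval_colorable:
  fixes \<epsilon> :: real and t :: nat
  assumes "\<epsilon> > 0" and "t > 0"
  shows "\<exists>N. \<forall>(V :: 'a set) E. simple_graph V E \<longrightarrow> N \<le> card V \<longrightarrow> 2 * \<epsilon> * (card V)\<^sup>2 \<le> card E \<longrightarrow>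
    (\<exists>F\<subseteq>E. interval_colorable V F \<and> \<epsilon> * t / 2 * card V \<le> card F)"
proof -
  obtain N where N: "\<And>n (V :: 'a set) E. n \<ge> N \<Longrightarrow> simple_graph V E \<Longrightarrow> card V \<le> n \<Longrightarrow>
      \<epsilon> * n\<^sup>2 \<le> card E \<Longrightarrow> \<exists>A B. A \<subseteq> V \<and> B \<subseteq> V \<and> A \<inter> B = {} \<and> card A = t \<and> card B = t \<and>
      complete_bipartite A B \<subseteq> E"
    using ex_complete_bipartite[OF \<open>\<epsilon> > 0\<close>, of t] by metis
  show ?thesis
  proof (intro exI[of _ N] allI impI)
    fix V :: "'a set" and E
    assume G: "simple_graph V E" and large: "N \<le> card V" and dense: "2 * \<epsilon> * (card V)\<^sup>2 \<le> card E"
    have fin: "finite V" "finite E"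
      using G simple_graph_finite_edges by (auto simp: simple_graph_def)
    \<comment> \<open>\<open>C\<close> is the covered set. Instead of the list of copies,
      \<open>Q\<close> keeps only what is needed of their union \<open>F\<close>: colorability and
      \<open>t / 2\<close> edges per covered vertex.\<close>
    define Q where "Q = (\<lambda>C. C \<subseteq> V \<and>
      (\<exists>F\<subseteq>E. \<Union>F \<subseteq> C \<and> interval_colorable V F \<and> t * card C \<le> 2 * card F))"
    have "interval_colorable V {}" by (rule interval_colorable_matching) simp
    then have "Q {}" unfolding Q_def by auto
    moreover have "\<forall>C. Q C \<longrightarrow> card C < card V + 1"
      using fin by (auto simp: Q_def less_Suc_eq_le card_mono)
    ultimately obtain C where C: "Q C" and maxC: "\<And>D. Q D \<Longrightarrow> card D \<le> card C"
      using ex_has_greatest_nat[of Q "{}" card "card V + 1"] by blast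
    obtain F where F: "C \<subseteq> V" "F \<subseteq> E" "\<Union>F \<subseteq> C" "interval_colorable V F" "t * card C \<le> 2 * card F"
      using C unfolding Q_def by blast
    have "\<epsilon> * card V \<le> card C"
    proof (rule ccontr)
      assume small: "\<not> \<epsilon> * card V \<le> card C"
      define D where "D = {e\<in>E. e \<inter> C = {}}"
      \<comment> \<open>Fewer than \<epsilon> n^2 edges meet \<open>C\<close>, where
        \<open>n\<close> is \<open>card V\<close>, so at least \<epsilon> n^2 edges avoid
        it.\<close>
      have "card E = card ({e\<in>E. e \<inter> C \<noteq> {}} \<union> D)" by (rule arg_cong[of _ _ card]) (auto simp: D_def)
      also have "\<dots> \<le> card {e\<in>E. e \<inter> C \<noteq> {}} + card D" by (rule card_Un_le)
      also have "card {e\<in>E. e \<inter> C \<noteq> {}} \<le> card C * card V" by (rule card_edges_meeting_le[OF G F(1)])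
      finally have "real (card E) \<le> real (card C) * card V + card D"
        by (simp flip: of_nat_mult of_nat_add)
      also have "real (card C) * card V \<le> (\<epsilon> * card V) * card V"
        using small by (intro mult_right_mono) auto
      finally have denseD: "\<epsilon> * (card V)\<^sup>2 \<le> card D" using dense by (simp add: power2_eq_square)
      have graphD: "simple_graph (V - C) D"
        using G by (auto simp: simple_graph_def D_def)
      have "card (V - C) \<le> card V" using fin by (intro card_mono) auto
      \<comment> \<open>Although \<open>V - C\<close> is smaller, the density is still measured
        against \<open>card V\<close>.\<close>
      from N[OF large graphD this denseD] obtain A B where AB: "A \<subseteq> V - C" "B \<subseteq> V - C" "A \<inter> B = {}" "card A = t" "card B = t"
        "complete_bipartite A B \<subseteq> D"
        by blast
      have finAB: "finite A" "finite B" "finite C" "finite F"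
        using AB F fin by (auto intro: finite_subset)
      let ?K = "complete_bipartite A B"
      have sub: "\<Union>?K \<subseteq> A \<union> B" by (rule Union_complete_bipartite_subset)
      have "interval_colorable V (F \<union> ?K)"
        by (intro interval_colorable_disjoint_Un interval_colorable_complete_bipartite)
          (use F finAB AB sub in blast)+
      moreover have cardK: "card ?K = t * t" using card_complete_bipartite[OF AB(3)] AB by simp
      have cardC: "card (C \<union> A \<union> B) = card C + t + t"
        using AB finAB by (subst card_Un_disjoint; (subst card_Un_disjoint)?) auto
      moreover have "F \<inter> ?K = {}"
      proof -
        have "e \<inter> C = {}" "e \<noteq> {}" if "e \<in> ?K" for e
          using that AB(6) by (auto simp: D_def complete_bipartite_def)
        then show ?thesis using F(3) by blast
      qed
      \<comment> \<open>A new copy adds \<open>2 * t\<close> vertices and \<open>t * t\<close>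
        edges, which preserves the ratio required by \<open>Q\<close>.\<close>
      then have "card (F \<union> ?K) = card F + t * t"
        using finAB cardK by (subst card_Un_disjoint) (auto simp: complete_bipartite_def)
      then have "t * card (C \<union> A \<union> B) \<le> 2 * card (F \<union> ?K)"
        using F(5) cardC by (simp add: algebra_simps)
      moreover have "F \<union> ?K \<subseteq> E" "\<Union>(F \<union> ?K) \<subseteq> C \<union> A \<union> B" "C \<union> A \<union> B \<subseteq> V"
        using F AB sub by (auto simp: D_def)
      ultimately have "Q (C \<union> A \<union> B)" unfolding Q_def by blast
      from maxC[OF this] cardC \<open>t > 0\<close> show False by simp
    qed
    then have "t * (\<epsilon> * card V) \<le> t * real (card C)" by (intro mult_left_mono) auto
    also have "\<dots> \<le> 2 * real (card F)"
      using of_nat_mono[OF F(5), where 'a = real] by simp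
    finally have "\<epsilon> * t / 2 * card V \<le> card F" by (simp add: algebra_simps)
    then show "\<exists>F\<subseteq>E. interval_colorable V F \<and> \<epsilon> * t / 2 * card V \<le> card F"
      using F by blast
  qed
qed

text \<open>Removing one \<open>F\<close> costs one color class and lowers \<open>card E / q\<close>
  by at least 1. Once the graph is sparse, \<open>interval_thickness_sparse\<close> pays the first
  summand.\<close>

lemma interval_thickness_peeling:
  fixes \<delta> q :: real
  assumes "simple_graph V E" and "\<delta> > 0" and "q > 0" and "card V > 0"
    and peel: "\<And>E. simple_graph V E \<Longrightarrow> \<delta>\<^sup>2 * (card V)\<^sup>2 \<le> card E \<Longrightarrow>
      \<exists>F\<subseteq>E. interval_colorable V F \<and> q \<le> card F"
  shows "interval_thickness V E \<le> 4 * \<delta> * card V + card E / q"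
  using assms(1)
proof (induction "card E" arbitrary: E rule: less_induct)
  case less
  show ?case
  proof (cases "\<delta>\<^sup>2 * (card V)\<^sup>2 \<le> card E")
    case False
    then have "interval_thickness V E \<le> 4 * \<delta> * card V"
      using interval_thickness_sparse[OF less.prems \<open>\<delta> > 0\<close> refl \<open>card V > 0\<close>] by simp
    moreover have "0 \<le> card E / q" using \<open>q > 0\<close> by simp
    ultimately show ?thesis by linarith
  next
    case True
    then obtain F where F: "F \<subseteq> E" "interval_colorable V F" "q \<le> card F"
      using peel[OF less.prems] by blast
    have finE: "finite E" by (rule simple_graph_finite_edges[OF less.prems])
    have cardE: "card (E - F) = card E - card F" "card F \<le> card E"
      using F finE by (auto simp: card_Diff_subset finite_subset card_mono)
    have "card F > 0" using F(3) \<open>q > 0\<close> by linarith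
    then have "card (E - F) < card E" using cardE by linarith
    moreover have "simple_graph V (E - F)" using less.prems by (auto simp: simple_graph_def)
    ultimately have IH: "interval_thickness V (E - F) \<le> 4 * \<delta> * card V + card (E - F) / q"
      by (rule less.hyps)
    have "interval_thickness V (F \<union> (E - F)) \<le> interval_thickness V F + interval_thickness V (E - F)"
      by (rule interval_thickness_Un_le) auto
    moreover have "F \<union> (E - F) = E" using F by blast
    ultimately have "interval_thickness V E \<le> 1 + interval_thickness V (E - F)"
      using interval_thickness_le_1[OF F(2)] by simp
    moreover have "1 + card (E - F) / q \<le> card E / q"
      using cardE F(3) \<open>q > 0\<close> by (simp add: field_simps of_nat_diff)
    ultimately show ?thesis using IH by linarith
  qed
qed

section \<open>Choice of constants and the limit\<close>

lemma interval_thickness_eventually_le: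
  fixes \<delta> :: real
  assumes "\<delta> > 0"
  shows "\<exists>N. \<forall>(V :: 'a set) E. simple_graph V E \<longrightarrow> N \<le> card V \<longrightarrow>
    interval_thickness V E \<le> 5 * \<delta> * card V"
proof -
  \<comment> \<open>Matches the density threshold of the previous two lemmas: twice \<epsilon> is
    the square of \<delta>.\<close>
  define \<epsilon> where "\<epsilon> = \<delta>\<^sup>2 / 2"
  have "\<epsilon> > 0" using assms by (simp add: \<epsilon>_def)
  \<comment> \<open>With n = \<open>card V\<close>, at most n^2 edges are removed at a rate of
    \<epsilon> t n / 2 per step. The number of steps is thus at most 2 n / (\<epsilon> t), which
    this \<open>t\<close> makes at most \<delta> n.\<close>
  define t where "t = nat \<lceil>2 / (\<epsilon> * \<delta>)\<rceil> + 1"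
  have "2 / (\<epsilon> * \<delta>) \<le> t" "t > 0" unfolding t_def by linarith+
  then have t: "2 \<le> \<delta> * (\<epsilon> * t)" "t > 0"
    using \<open>\<epsilon> > 0\<close> \<open>\<delta> > 0\<close> by (simp_all add: field_simps)
  obtain N where N: "\<And>(V :: 'a set) E. simple_graph V E \<Longrightarrow> N \<le> card V \<Longrightarrow>
      2 * \<epsilon> * (card V)\<^sup>2 \<le> card E \<Longrightarrow>
      \<exists>F\<subseteq>E. interval_colorable V F \<and> \<epsilon> * t / 2 * card V \<le> card F"
    using ex_large_interval_colorable[OF \<open>\<epsilon> > 0\<close> t(2)] by metis
  show ?thesis
  \<comment> \<open>The extra 1 makes \<open>card V\<close>, and hence \<open>q\<close>,
    positive.\<close>
  proof (intro exI[of _ "N + 1"] allI impI)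
    fix V :: "'a set" and E
    assume G: "simple_graph V E" and large: "N + 1 \<le> card V"
    define q where "q = \<epsilon> * t / 2 * card V"
    have q: "q > 0" using \<open>\<epsilon> > 0\<close> t large by (simp add: q_def)
    have "interval_thickness V E \<le> 4 * \<delta> * card V + card E / q"
    proof (rule interval_thickness_peeling[OF G \<open>\<delta> > 0\<close> q])
      show "card V > 0" using large by simp
      show "\<exists>F\<subseteq>E. interval_colorable V F \<and> q \<le> card F"
        if "simple_graph V E" "\<delta>\<^sup>2 * (card V)\<^sup>2 \<le> card E" for E
        using N[OF that(1)] that(2) large unfolding q_def \<epsilon>_def by simp
    qed
    moreover have "card E / q \<le> \<delta> * card V"
    proof -
      have "e \<inter> V \<noteq> {}" if "e \<in> E" for e
      proof -
        have "e \<subseteq> V" "card e = 2" using G that by (auto simp: simple_graph_def)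
        then show ?thesis by (metis card.empty inf.absorb1 zero_neq_numeral)
      qed
      then have "{e\<in>E. e \<inter> V \<noteq> {}} = E" by blast
      then have "card E \<le> card V * card V" using card_edges_meeting_le[OF G subset_refl] by simp
      then have "real (card E) \<le> real (card V) * card V"
        using of_nat_mono[where 'a = real] by fastforce
      also have "\<dots> * 2 \<le> (real (card V) * card V) * (\<delta> * (\<epsilon> * t))"
        by (intro mult_left_mono t) auto
      then have "real (card V) * card V \<le> (\<delta> * card V) * q" by (simp add: q_def algebra_simps)
      finally show ?thesis using q by (simp add: divide_le_eq)
    qed
    ultimately show "interval_thickness V E \<le> 5 * \<delta> * card V" by simp
  qed
qed

theorem theorem2:
  shows "(\<lambda>n. real (max_interval_thickness n) / real n) \<longlonglongrightarrow> 0"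
proof (rule LIMSEQ_I)
  fix r :: real
  assume "r > 0"
  \<comment> \<open>The resulting bound on the quotient is \<open>r / 2\<close>, which leaves room
    for the strict inequality.\<close>
  define \<delta> where "\<delta> = r / 10"
  have "\<delta> > 0" using \<open>r > 0\<close> by (simp add: \<delta>_def)
  then obtain N where N: "\<And>(V :: nat set) E. simple_graph V E \<Longrightarrow> N \<le> card V \<Longrightarrow>
      interval_thickness V E \<le> 5 * \<delta> * card V"
    using interval_thickness_eventually_le[of \<delta>] by metis
  have "norm (real (max_interval_thickness n) / real n - 0) < r" if "n \<ge> N + 1" for n
  proof -
    obtain V :: "nat set" and E where V: "simple_graph V E" "card V = n"
      "interval_thickness V E = max_interval_thickness n"
      using max_interval_thickness_attained by blast
    have "max_interval_thickness n \<le> 5 * \<delta> * n" using N[OF V(1)] V that by simp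
    also have "\<dots> < r * n" using \<open>r > 0\<close> that by (simp add: \<delta>_def)
    finally show ?thesis using that by (simp add: divide_less_eq)
  qed
  then show "\<exists>no. \<forall>n\<ge>no. norm (real (max_interval_thickness n) / real n - 0) < r" by blast
qed

end
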